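(* Let $0=t_0<t_1<\dots<t_K=T$ be integers and let $P_1,\dots,P_K\ge0$. Let $f_1,\dots,f_T:\mathcal K\to\mathbb R$ be convex, and let $x_1^*,\dots,x_T^*\in\mathcal K$ satisfy, for every $1\le k\le K$, $$\sum_{t=t_{k-1}+1}^{t_k-1}\|x_{t+1}^*-x_t^*\|\le P_k ,$$ where $P_k$ and $t_k$ are made known to the algorithm at the latest following round $t_{k-1}$. Suppose projected subgradient descent is reset following each round $t_{k-1}$ and uses, for $t_{k-1}<t\le t_k$, the adaptive step sizes $$\eta_t=D\,\sqrt{P_k/D+1/2}\,\Bigl(\sum_{\tau=t_{k-1}+1}^{t}\|g_\tau\|^2\Bigr)^{-1/2}.$$ Then the decisions $x_1,\dots,x_T$ satisfy $$\sum_{t=1}^T\bigl(f_t(x_t)-f_t(x_t^* )\bigr)\le\sum_{k=1}^K 2D\sqrt{P_k/D+1/2}\;\sqrt{\sum_{t=t_{k-1}+1}^{t_k}\|g_t\|^2}.$$ Moreover, if either $K\le C\sum_{k=1}^K P_k/D$ for some constant $C$, or $K$ is bounded by a constant, then this upper bound is minimax optimal within a constant factor: there is a constant $c$, depending only on $C$ (respectively on the bound for $K$), such that the right-hand side above is at most $$c\cdot\frac{D\,G_T}{2\sqrt2}\sqrt{\lfloor P/D\rfloor+1},\qquad P=\sum_{k=1}^K P_k,\quad G_T=\sqrt{\sum_{t=1}^T\|g_t\|^2}.$$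
   Context: $\mathcal K\subset\mathbb R^N$ is a nonempty convex, closed and bounded set with diameter $D=\sup_{x,v\in\mathcal K}\|x-v\|>0$; $\|\cdot\|$ is the Euclidean norm and $\mathrm{Proj}_{\mathcal K}(x)=\arg\min_{v\in\mathcal K}\|x-v\|^2$. For convex $f:\mathcal K\to\mathbb R$, $\partial f(x)$ is the set of $g\in\mathbb R^N$ with $f(x)-f(v)\le g^\top(x-v)$ for all $v\in\mathcal K$. Online projected subgradient descent with step sizes $\eta_t$: at each round $t$ of a run, with current decision $x_t\in\mathcal K$, receive a subgradient $g_t\in\partial f_t(x_t)$; if $g_t=0$ set $x_{t+1}=x_t$, otherwise set $x_{t+1}=\mathrm{Proj}_{\mathcal K}(x_t-\eta_t g_t)$. No step size is needed while all subgradients of the run so far are zero. Resetting following round $s$ means that a new run starts at round $s+1$ from an arbitrary point of $\mathcal K$, with the accumulated sum of squared subgradient norms restarted from zero. "Minimax optimal within a constant factor" refers to comparison with the worst-case dynamic regret lower bound $\frac{D G_T}{2\sqrt2}\sqrt{\lfloor P/D\rfloor+1}$, valid for every causal algorithm against comparators of path variation at most $P$. *)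

theory Defs
  imports "HOL-Analysis.Analysis"
begin

(* Loss functions are total functions on the ambient space, but only their values on S matter:
   convexity, subgradients and comparators are all relative to S. *)
definition subdifferential :: "'a::real_inner set \<Rightarrow> ('a \<Rightarrow> real) \<Rightarrow> 'a \<Rightarrow> 'a set" where
  "subdifferential S f x = {g. \<forall>v\<in>S. f x - f v \<le> g \<bullet> (x - v)}"

(* One run over the rounds a+1, ..., b, started at an arbitrary point of S. The step size is
   irrelevant in rounds with zero subgradient. The update after round b is not constrained, since
   a reset follows that round (or the horizon ends). *)
definition projected_subgradient_run ::
  "'a::euclidean_space set \<Rightarrow> (nat \<Rightarrow> real) \<Rightarrow> nat \<Rightarrow> nat \<Rightarrow> (nat \<Rightarrow> 'a \<Rightarrow> real)
     \<Rightarrow> (nat \<Rightarrow> 'a) \<Rightarrow> (nat \<Rightarrow> 'a) \<Rightarrow> bool" where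
  "projected_subgradient_run S \<eta> a b f x g \<longleftrightarrow>
     x (Suc a) \<in> S \<and>
     (\<forall>t\<in>{a<..b}. g t \<in> subdifferential S (f t) (x t)) \<and>
     (\<forall>t\<in>{a<..<b}. x (Suc t) =
        (if g t = 0 then x t else closest_point S (x t - \<eta> t *\<^sub>R g t)))"

(* When all subgradients since round a are zero this is a division by zero, hence 0; a run never
   uses the value in that case. *)
definition adaptive_step :: "real \<Rightarrow> real \<Rightarrow> nat \<Rightarrow> (nat \<Rightarrow> 'a::real_normed_vector) \<Rightarrow> nat \<Rightarrow> real" where
  "adaptive_step D p a g t =
     D * sqrt (p / D + 1 / 2) / sqrt (\<Sum>\<tau>\<in>{a<..t}. (norm (g \<tau>))\<^sup>2)"

definition reset_schedule :: "nat \<Rightarrow> nat \<Rightarrow> (nat \<Rightarrow> nat) \<Rightarrow> bool" where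
  "reset_schedule K T r \<longleftrightarrow> 1 \<le> K \<and> r 0 = 0 \<and> (\<forall>k\<in>{1..K}. r (k - 1) < r k) \<and> r K = T"

definition adaptive_restarted_run ::
  "'a::euclidean_space set \<Rightarrow> nat \<Rightarrow> (nat \<Rightarrow> nat) \<Rightarrow> (nat \<Rightarrow> real) \<Rightarrow> (nat \<Rightarrow> 'a \<Rightarrow> real)
     \<Rightarrow> (nat \<Rightarrow> 'a) \<Rightarrow> (nat \<Rightarrow> 'a) \<Rightarrow> bool" where
  "adaptive_restarted_run S K r P f x g \<longleftrightarrow>
     (\<forall>k\<in>{1..K}. projected_subgradient_run S
        (adaptive_step (diameter S) (P k) (r (k - 1)) g) (r (k - 1)) (r k) f x g)"

(* The two bounds depend on the data only through the diameter D, the resets r, the path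
   variations and the subgradient norms \<gamma>. *)
definition restarted_regret_bound ::
  "real \<Rightarrow> nat \<Rightarrow> (nat \<Rightarrow> nat) \<Rightarrow> (nat \<Rightarrow> real) \<Rightarrow> (nat \<Rightarrow> real) \<Rightarrow> real" where
  "restarted_regret_bound D K r P \<gamma> =
     (\<Sum>k=1..K. 2 * D * sqrt (P k / D + 1 / 2) * sqrt (\<Sum>t\<in>{r (k - 1)<..r k}. (\<gamma> t)\<^sup>2))"

(* The worst-case dynamic regret lower bound for causal algorithms and comparators of path
   variation at most V. *)
definition dynamic_regret_lower_bound :: "real \<Rightarrow> nat \<Rightarrow> real \<Rightarrow> (nat \<Rightarrow> real) \<Rightarrow> real" where
  "dynamic_regret_lower_bound D T V \<gamma> =
     D * sqrt (\<Sum>t=1..T. (\<gamma> t)\<^sup>2) / (2 * sqrt 2) * sqrt (of_int \<lfloor>V / D\<rfloor> + 1)"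

end

theory Submission
  imports Defs
begin

text \<open>
  Within one run put \<open>G\<^sub>t = sqrt (\<Sum>\<tau>\<le>t. \<parallel>g\<^sub>\<tau>\<parallel>\<^sup>2)\<close> and \<open>c = D * sqrt (p / D + 1 / 2)\<close>, so that
  \<open>\<eta>\<^sub>t = c / G\<^sub>t\<close>. Expanding the projected step bounds \<open>g\<^sub>t \<bullet> (x\<^sub>t - x\<^sub>t\<^sup>*)\<close> by a decrease of the squared
  distance to the comparator, weighted with \<open>G\<^sub>t / (2 * c)\<close>, plus \<open>c * \<parallel>g\<^sub>t\<parallel>\<^sup>2 / (2 * G\<^sub>t)\<close>, and the latter
  is at most \<open>c * (G\<^sub>t - G\<^sub>t\<^sub>-\<^sub>1)\<close>. Moving the comparator raises the squared distance by at most \<open>2 * D\<close>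
  times its displacement, and since the weights increase, the run has regret at most
  \<open>(G / c) * (D\<^sup>2 / 2 + D * p) + c * G = 2 * c * G\<close>. The optimality claims follow from the
  Cauchy--Schwarz inequality over the runs.
\<close>

section \<open>Sums over the blocks of a reset schedule\<close>

text \<open>The conjunct \<open>r 0 \<le> r K\<close> is carried through the induction because
  appending the next block to \<open>{r 0<..r K}\<close> needs ordered endpoints.\<close>

lemma sum_blocks:
  fixes r :: "nat \<Rightarrow> nat" and h :: "nat \<Rightarrow> 'b::comm_monoid_add"
  assumes "\<And>k. k \<in> {1..K} \<Longrightarrow> r (k - 1) \<le> r k"
  shows "(\<Sum>k=1..K. \<Sum>t\<in>{r (k - 1)<..r k}. h t) = (\<Sum>t\<in>{r 0<..r K}. h t) \<and> r 0 \<le> r K"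
  using assms
proof (induction K)
  case 0
  then show ?case by simp
next
  case (Suc K)
  have IH: "(\<Sum>k=1..K. \<Sum>t\<in>{r (k - 1)<..r k}. h t) = (\<Sum>t\<in>{r 0<..r K}. h t)" "r 0 \<le> r K"
    using Suc by auto
  have le: "r K \<le> r (Suc K)"
    using Suc.prems[of "Suc K"] by simp
  have "(\<Sum>t\<in>{r 0<..r (Suc K)}. h t) = (\<Sum>t\<in>{r 0<..r K}. h t) + (\<Sum>t\<in>{r K<..r (Suc K)}. h t)"
    using IH(2) le by (subst sum.union_disjoint[symmetric]) (auto simp: ivl_disj_un)
  then show ?case
    using IH le by simp
qed

lemma sum_reset_schedule:
  fixes h :: "nat \<Rightarrow> 'b::comm_monoid_add"
  assumes "reset_schedule K T r"
  shows "(\<Sum>k=1..K. \<Sum>t\<in>{r (k - 1)<..r k}. h t) = (\<Sum>t=1..T. h t)"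
proof -
  have "{0<..T} = {1..T}"
    by auto
  then show ?thesis
    using sum_blocks[of K r h] assms by (auto simp: reset_schedule_def less_imp_le)
qed

lemma reset_schedule_mono:
  assumes "reset_schedule K T r" and "i \<le> j" and "j \<le> K"
  shows "r i \<le> r j"
  using assms(2,3)
proof (induction j)
  case 0
  then show ?case by simp
next
  case (Suc j)
  have "r j < r (Suc j)"
    using assms(1) Suc.prems unfolding reset_schedule_def
    by (metis Suc_eq_plus1 atLeastAtMost_iff diff_Suc_1 le_add2)
  then show ?case
    using Suc by (cases "i = Suc j") auto
qed

section \<open>Inequalities for a single step\<close>

lemma norm_closest_point_diff_le:
  fixes S :: "'a::euclidean_space set"
  assumes "convex S" "closed S" "v \<in> S"
  shows "norm (closest_point S z - v) \<le> norm (z - v)"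
  using closest_point_lipschitz[of S z v] closest_point_self[of v S] assms
  by (auto simp: dist_norm)

text \<open>Projection does not increase the distance to \<open>v\<close>, so expanding the square
  of the unprojected step bounds the new squared distance; it remains to solve for the inner
  product.\<close>

lemma subgradient_step:
  fixes S :: "'a::euclidean_space set"
  assumes "convex S" "closed S" "v \<in> S" "0 < \<eta>"
  shows "g \<bullet> (x - v) \<le>
    ((norm (x - v))\<^sup>2 - (norm (closest_point S (x - \<eta> *\<^sub>R g) - v))\<^sup>2) / (2 * \<eta>) + \<eta> / 2 * (norm g)\<^sup>2"
proof -
  have "(norm (closest_point S (x - \<eta> *\<^sub>R g) - v))\<^sup>2 \<le> (norm ((x - v) - \<eta> *\<^sub>R g))\<^sup>2"
    using norm_closest_point_diff_le[OF assms(1-3), of "x - \<eta> *\<^sub>R g"]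
    by (intro power_mono) (simp_all add: algebra_simps)
  also have "\<dots> = (norm (x - v))\<^sup>2 - 2 * \<eta> * (g \<bullet> (x - v)) + \<eta>\<^sup>2 * (norm g)\<^sup>2"
    unfolding power2_norm_eq_inner
    by (simp add: inner_diff_left inner_diff_right inner_commute power2_eq_square algebra_simps)
  finally show ?thesis
    using assms(4) by (simp add: field_simps power2_eq_square)
qed

text \<open>Young's inequality: the estimate of \<open>subgradient_step\<close> without the new
  distance, hence without a next iterate.\<close>

lemma inner_le_weighted:
  fixes u g :: "'a::real_inner"
  assumes "0 < \<eta>"
  shows "g \<bullet> u \<le> (norm u)\<^sup>2 / (2 * \<eta>) + \<eta> / 2 * (norm g)\<^sup>2"
proof -
  have "0 \<le> (norm (u - \<eta> *\<^sub>R g))\<^sup>2"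
    by simp
  also have "\<dots> = (norm u)\<^sup>2 - 2 * \<eta> * (g \<bullet> u) + \<eta>\<^sup>2 * (norm g)\<^sup>2"
    unfolding power2_norm_eq_inner
    by (simp add: inner_diff_left inner_diff_right inner_commute power2_eq_square algebra_simps)
  finally show ?thesis
    using assms by (simp add: field_simps power2_eq_square)
qed

text \<open>The difference of squares is the inner product of \<open>u - v\<close> with a sum of two
  vectors of norm at most \<open>D\<close>. This prices a move of the comparator from
  \<open>u\<close> to \<open>v\<close>.\<close>

lemma norm_square_shift_le:
  fixes y u v :: "'a::real_inner"
  assumes "norm (y - u) \<le> D" "norm (y - v) \<le> D"
  shows "(norm (y - v))\<^sup>2 \<le> (norm (y - u))\<^sup>2 + 2 * D * norm (v - u)"
proof -
  have "(norm (y - v))\<^sup>2 - (norm (y - u))\<^sup>2 = (u - v) \<bullet> ((y - u) + (y - v))"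
    unfolding power2_norm_eq_inner
    by (simp add: inner_diff_left inner_diff_right inner_add_right inner_commute algebra_simps)
  also have "\<dots> \<le> norm (u - v) * norm ((y - u) + (y - v))"
    by (rule norm_cauchy_schwarz)
  also have "\<dots> \<le> norm (u - v) * (2 * D)"
    using norm_triangle_ineq[of "y - u" "y - v"] assms by (intro mult_left_mono) auto
  finally show ?thesis
    by (simp add: norm_minus_commute algebra_simps)
qed

text \<open>Since \<open>q = (b - a) * (b + a)\<close> and \<open>b + a \<le> 2 * b\<close>, the
  cost of a step is dominated by a difference that telescopes over the rounds.\<close>

lemma square_div_le_root_diff:
  fixes a b q c :: real
  assumes "0 \<le> a" "a \<le> b" "0 < b" "0 \<le> c" "b\<^sup>2 = a\<^sup>2 + q"
  shows "c / b / 2 * q \<le> c * (b - a)"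
proof -
  have "q = (b - a) * (b + a)"
    using assms(5) by (simp add: power2_eq_square algebra_simps)
  also have "\<dots> \<le> (b - a) * (2 * b)"
    using assms by (intro mult_left_mono) auto
  finally have "c / b / 2 * q \<le> c / b / 2 * ((b - a) * (2 * b))"
    using assms by (intro mult_left_mono) auto
  then show ?thesis
    using assms(3) by simp
qed

section \<open>Regret of one run\<close>

lemma regret_single_run:
  fixes S :: "'a::euclidean_space set"
  assumes "convex S" "closed S" "bounded S" and D: "0 < diameter S" and "0 \<le> p" "a < b"
    and comparator: "\<And>t. t \<in> {a<..b} \<Longrightarrow> xs t \<in> S"
    and variation: "(\<Sum>t\<in>{a<..<b}. norm (xs (Suc t) - xs t)) \<le> p"
    and run: "projected_subgradient_run S (adaptive_step (diameter S) p a g) a b f x g"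
  shows "(\<Sum>t\<in>{a<..b}. f t (x t) - f t (xs t))
    \<le> 2 * diameter S * sqrt (p / diameter S + 1 / 2) * sqrt (\<Sum>t\<in>{a<..b}. (norm (g t))\<^sup>2)"
proof -
  define D where "D = diameter S"
  define c where "c = D * sqrt (p / D + 1 / 2)"
  define s where "s n = sqrt (\<Sum>\<tau>\<in>{a<..n}. (norm (g \<tau>))\<^sup>2)" for n
  define \<eta> where "\<eta> n = c / s n" for n
  define V where "V n = (\<Sum>t\<in>{a<..n}. norm (xs (Suc t) - xs t))" for n
  define L where "L n = (\<Sum>t\<in>{a<..n}. g t \<bullet> (x t - xs t))" for n
  have Dpos: "0 < D"
    using D by (simp add: D_def)
  have cpos: "0 < c"
    using Dpos \<open>0 \<le> p\<close> by (auto simp: c_def intro!: mult_pos_pos add_nonneg_pos)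
  \<comment> \<open>This identity explains the factor in the step size: distance and variation will
    contribute \<open>s b / c * c\<^sup>2\<close>, which equals the step cost
    \<open>c * s b\<close>.\<close>
  have csq: "c\<^sup>2 = D\<^sup>2 / 2 + D * p"
    using Dpos \<open>0 \<le> p\<close> by (simp add: c_def power_mult_distrib power2_eq_square field_simps)
  have ins: "{a<..Suc n} = insert (Suc n) {a<..n}" if "a \<le> n" for n
    using that by auto
  have sS: "(s (Suc n))\<^sup>2 = (s n)\<^sup>2 + (norm (g (Suc n)))\<^sup>2" if "a \<le> n" for n
    using ins[OF that] by (simp add: s_def sum_nonneg)
  have s0: "0 \<le> s n" for n
    by (simp add: s_def sum_nonneg)
  have smono: "s n \<le> s (Suc n)" if "a \<le> n" for n
    using sS[OF that] s0 by (metis le_add_same_cancel1 power2_le_imp_le zero_le_power2)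
  \<comment> \<open>Before the first nonzero subgradient \<open>s\<close> is 0 and
    \<open>\<eta>\<close> is 0 by division by zero; positivity is available exactly where a step is
    taken.\<close>
  have spos: "0 < s (Suc n)" if "a \<le> n" "g (Suc n) \<noteq> 0" for n
    using sS[OF that(1)] s0[of "Suc n"] that(2)
    by (smt (verit) power2_eq_square zero_eq_power2 zero_le_power2 norm_eq_zero)
  have sub: "g t \<in> subdifferential S (f t) (x t)" if "t \<in> {a<..b}" for t
    using run that by (auto simp: projected_subgradient_run_def)
  have upd: "x (Suc t) = (if g t = 0 then x t else closest_point S (x t - \<eta> t *\<^sub>R g t))"
    if "t \<in> {a<..<b}" for t
    using run that
    by (auto simp: projected_subgradient_run_def adaptive_step_def \<eta>_def c_def s_def D_def)
  have "S \<noteq> {}"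
    using D by auto
  have xin: "x (Suc n) \<in> S" if "a \<le> n" "n < b" for n
    using that
  proof (induction n rule: dec_induct)
    case base
    show ?case
      using run by (auto simp: projected_subgradient_run_def)
  next
    case (step n)
    then show ?case
      using upd[of "Suc n"] closest_point_in_set[OF \<open>closed S\<close> \<open>S \<noteq> {}\<close>] by auto
  qed
  have dist_le: "norm (y - z) \<le> D" if "y \<in> S" "z \<in> S" for y z
    using diameter_bounded_bound[OF \<open>bounded S\<close> that] by (simp add: dist_norm D_def)
  have VS: "V (Suc n) = V n + norm (xs (Suc (Suc n)) - xs (Suc n))" if "a \<le> n" for n
    using ins[OF that] by (simp add: V_def)
  have LS: "L (Suc n) = L n + g (Suc n) \<bullet> (x (Suc n) - xs (Suc n))" if "a \<le> n" for n
    using ins[OF that] by (simp add: L_def)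
  \<comment> \<open>The step sizes make the weight of the potential increase, so the new weight may be charged
    against the diameter before the next step is taken.\<close>
  have reweigh: "L n + s (Suc n) / (2 * c) * (norm (x (Suc n) - xs (Suc n)))\<^sup>2
      \<le> s (Suc n) / c * (D\<^sup>2 / 2 + D * V n) + c * s n"
    if n: "a \<le> n" "n < b"
      and IH: "L n + s n / (2 * c) * (norm (x (Suc n) - xs (Suc n)))\<^sup>2
        \<le> s n / c * (D\<^sup>2 / 2 + D * V n) + c * s n" for n
  proof -
    have "(norm (x (Suc n) - xs (Suc n)))\<^sup>2 \<le> D\<^sup>2"
      using dist_le[OF xin comparator] n by (intro power_mono) auto
    then have "(s (Suc n) - s n) / (2 * c) * (norm (x (Suc n) - xs (Suc n)))\<^sup>2
        \<le> (s (Suc n) - s n) / (2 * c) * D\<^sup>2"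
      using smono[OF n(1)] cpos by (intro mult_left_mono) auto
    \<comment> \<open>The new weight also multiplies the variation term, which only enlarges the
      right-hand side.\<close>
    moreover have "0 \<le> (s (Suc n) - s n) / c * (D * V n)"
      using smono[OF n(1)] cpos Dpos
      by (intro mult_nonneg_nonneg divide_nonneg_pos) (auto simp: V_def intro: sum_nonneg)
    ultimately show ?thesis
      using IH cpos by (simp add: diff_divide_distrib algebra_simps)
  qed
  have gain: "\<eta> (Suc n) / 2 * (norm (g (Suc n)))\<^sup>2 \<le> c * (s (Suc n) - s n)"
    if "a \<le> n" "g (Suc n) \<noteq> 0" for n
    using square_div_le_root_diff[OF s0 smono[OF that(1)] spos[OF that] _ sS[OF that(1)], of c] cpos
    by (simp add: \<eta>_def)
  \<comment> \<open>Here the comparator has already moved to \<open>xs (Suc n)\<close>, a move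
    counted in \<open>V n\<close>, while the weight is still \<open>s n\<close>. At
    \<open>n = a\<close> this weight is an empty sum, so both sides vanish.\<close>
  have potential: "L n + s n / (2 * c) * (norm (x (Suc n) - xs (Suc n)))\<^sup>2
      \<le> s n / c * (D\<^sup>2 / 2 + D * V n) + c * s n" if "a \<le> n" "n < b" for n
    using that
  proof (induction n rule: dec_induct)
    case base
    show ?case
      by (simp add: L_def s_def)
  next
    case (step n)
    let ?w = "s (Suc n) / c"
    have n: "a \<le> n" "n < b" "Suc n < b"
      using step by auto
    have w0: "0 \<le> ?w"
      using s0 cpos by simp
    \<comment> \<open>The iterate moves first, against the fixed comparator
      \<open>xs (Suc n)\<close>; \<open>shift\<close> below then moves the comparator.\<close>
    have advance: "g (Suc n) \<bullet> (x (Suc n) - xs (Suc n))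
        \<le> ?w / 2 * ((norm (x (Suc n) - xs (Suc n)))\<^sup>2 - (norm (x (Suc (Suc n)) - xs (Suc n)))\<^sup>2)
          + c * (s (Suc n) - s n)"
    proof (cases "g (Suc n) = 0")
      case True
      then show ?thesis
        using upd[of "Suc n"] n smono[OF n(1)] cpos by simp
    next
      case False
      \<comment> \<open>The weight \<open>?w / 2\<close> is the reciprocal of twice this step size,
        which matches \<open>subgradient_step\<close>.\<close>
      have "0 < \<eta> (Suc n)"
        using spos[OF n(1) False] cpos by (simp add: \<eta>_def)
      from subgradient_step[OF \<open>convex S\<close> \<open>closed S\<close> comparator this, of "Suc n" "g (Suc n)" "x (Suc n)"]
      show ?thesis
        using upd[of "Suc n"] n False gain[OF n(1) False] by (simp add: \<eta>_def mult.commute)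
    qed
    have "(norm (x (Suc (Suc n)) - xs (Suc (Suc n))))\<^sup>2
        \<le> (norm (x (Suc (Suc n)) - xs (Suc n)))\<^sup>2 + 2 * D * norm (xs (Suc (Suc n)) - xs (Suc n))"
      using n by (intro norm_square_shift_le dist_le xin comparator) auto
    then have shift: "?w / 2 * (norm (x (Suc (Suc n)) - xs (Suc (Suc n))))\<^sup>2
        \<le> ?w / 2 * ((norm (x (Suc (Suc n)) - xs (Suc n)))\<^sup>2
            + 2 * D * norm (xs (Suc (Suc n)) - xs (Suc n)))"
      using w0 by (intro mult_left_mono) auto
    show ?case
      using reweigh[OF n(1,2) step.IH[OF n(2)]] advance shift
      by (simp add: LS[OF n(1)] VS[OF n(1)] algebra_simps)
  qed
  obtain m where m: "b = Suc m" "a \<le> m"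
    using \<open>a < b\<close> by (metis less_Suc_eq_le less_imp_Suc_add le_add1)
  \<comment> \<open>For \<open>b = Suc m\<close> the sets \<open>{a<..m}\<close> and
    \<open>{a<..<b}\<close> agree: \<open>V m\<close> is the whole variation within the run.\<close>
  have Vm: "V m \<le> p"
    using variation m(1)
    by (simp add: V_def lessThan_Suc_atMost greaterThanAtMost_def greaterThanLessThan_def)
  \<comment> \<open>The update after the last round is unconstrained, so Young's inequality replaces the step.\<close>
  have last: "g b \<bullet> (x b - xs b) \<le> s b / (2 * c) * (norm (x b - xs b))\<^sup>2 + c * (s b - s m)"
  proof (cases "g b = 0")
    case True
    then show ?thesis
      using smono[OF m(2)] s0[of b] cpos by (simp add: m(1))
  next
    case False
    then have "0 < \<eta> b"
      using spos[of m] m cpos by (simp add: \<eta>_def)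
    from inner_le_weighted[OF this, of "g b" "x b - xs b"] show ?thesis
      using gain[of m] m False by (simp add: \<eta>_def mult.commute)
  qed
  have "L b \<le> s b / c * (D\<^sup>2 / 2 + D * V m) + c * s b"
    using reweigh[OF m(2) _ potential[OF m(2)]] last LS[OF m(2)] m(1) by (simp add: algebra_simps)
  also have "\<dots> \<le> s b / c * c\<^sup>2 + c * s b"
    unfolding csq using Vm s0 cpos Dpos by (intro add_right_mono mult_left_mono) auto
  also have "\<dots> = 2 * c * s b"
    using cpos by (simp add: power2_eq_square)
  finally have "L b \<le> 2 * c * s b" .
  moreover have "(\<Sum>t\<in>{a<..b}. f t (x t) - f t (xs t)) \<le> L b"
    unfolding L_def using sub comparator by (intro sum_mono) (auto simp: subdifferential_def)
  ultimately show ?thesis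
    by (simp add: c_def s_def D_def)
qed

section \<open>Adding up the runs\<close>

text \<open>The bound for one run holds from any starting point in \<open>S\<close>, so the bounds
  add up with no term coupling consecutive runs.\<close>

lemma restarted_regret:
  fixes S :: "'a::euclidean_space set"
  assumes S: "convex S" "closed S" "bounded S" "0 < diameter S"
    and sched: "reset_schedule K T r"
    and P: "\<And>k. k \<in> {1..K} \<Longrightarrow> 0 \<le> P k"
    and comparator: "\<And>t. t \<in> {1..T} \<Longrightarrow> xs t \<in> S"
    and variation: "\<And>k. k \<in> {1..K} \<Longrightarrow>
      (\<Sum>t\<in>{r (k - 1)<..<r k}. norm (xs (Suc t) - xs t)) \<le> P k"
    and run: "adaptive_restarted_run S K r P f x g"
  shows "(\<Sum>t=1..T. f t (x t) - f t (xs t))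
    \<le> restarted_regret_bound (diameter S) K r P (\<lambda>t. norm (g t))"
proof -
  have "(\<Sum>t\<in>{r (k - 1)<..r k}. f t (x t) - f t (xs t))
      \<le> 2 * diameter S * sqrt (P k / diameter S + 1 / 2)
        * sqrt (\<Sum>t\<in>{r (k - 1)<..r k}. (norm (g t))\<^sup>2)" if k: "k \<in> {1..K}" for k
  proof (rule regret_single_run[OF S P[OF k]])
    show "r (k - 1) < r k"
      using sched k by (auto simp: reset_schedule_def)
    show "xs t \<in> S" if "t \<in> {r (k - 1)<..r k}" for t
      using that k reset_schedule_mono[OF sched, of k K] sched
      by (intro comparator) (auto simp: reset_schedule_def)
  qed (use variation run k in \<open>auto simp: adaptive_restarted_run_def\<close>)
  then show ?thesis
    unfolding restarted_regret_bound_def sum_reset_schedule[OF sched, symmetric]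
    by (intro sum_mono)
qed

section \<open>Comparison with the lower bound\<close>

lemma sum_sqrt_mult_le:
  fixes u v :: "'b \<Rightarrow> real"
  assumes "\<And>i. i \<in> I \<Longrightarrow> 0 \<le> u i" "\<And>i. i \<in> I \<Longrightarrow> 0 \<le> v i"
  shows "(\<Sum>i\<in>I. sqrt (u i) * sqrt (v i)) \<le> sqrt (\<Sum>i\<in>I. u i) * sqrt (\<Sum>i\<in>I. v i)"
proof -
  have "(\<Sum>i\<in>I. sqrt (u i) * sqrt (v i))\<^sup>2 \<le> (\<Sum>i\<in>I. (sqrt (u i))\<^sup>2) * (\<Sum>i\<in>I. (sqrt (v i))\<^sup>2)"
    by (rule Cauchy_Schwarz_ineq_sum)
  also have "\<dots> = (\<Sum>i\<in>I. u i) * (\<Sum>i\<in>I. v i)"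
    using assms by (intro arg_cong2[where f = "(*)"] sum.cong) auto
  finally show ?thesis
    by (simp add: real_le_rsqrt flip: real_sqrt_mult)
qed

text \<open>Common form of both regimes: \<open>K\<close> is measured against the factor under the
  root of the lower bound. Cauchy-Schwarz leaves \<open>q + K / 2\<close> under the root, whence
  \<open>1 + C / 2\<close>; the ratio of \<open>2 * D\<close> to \<open>D / (2 * sqrt 2)\<close>
  gives \<open>4 * sqrt 2\<close>.\<close>

lemma restarted_regret_bound_le:
  assumes D: "0 < D" and sched: "reset_schedule K T r"
    and P: "\<And>k. k \<in> {1..K} \<Longrightarrow> 0 \<le> P k"
    and K: "real K \<le> C * (of_int \<lfloor>(\<Sum>k=1..K. P k) / D\<rfloor> + 1)"
  shows "restarted_regret_bound D K r P \<gamma>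
    \<le> 4 * sqrt 2 * sqrt (1 + C / 2) * dynamic_regret_lower_bound D T (\<Sum>k=1..K. P k) \<gamma>"
proof -
  define q where "q = (\<Sum>k=1..K. P k) / D"
  define G where "G = sqrt (\<Sum>t=1..T. (\<gamma> t)\<^sup>2)"
  have G0: "0 \<le> G"
    by (simp add: G_def sum_nonneg)
  have "(\<Sum>k=1..K. sqrt (P k / D + 1 / 2) * sqrt (\<Sum>t\<in>{r (k - 1)<..r k}. (\<gamma> t)\<^sup>2))
      \<le> sqrt (\<Sum>k=1..K. P k / D + 1 / 2) * sqrt (\<Sum>k=1..K. \<Sum>t\<in>{r (k - 1)<..r k}. (\<gamma> t)\<^sup>2)"
    using P D by (intro sum_sqrt_mult_le) (auto intro: sum_nonneg)
  also have "\<dots> = sqrt (q + real K / 2) * G"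
    unfolding sum_reset_schedule[OF sched]
    by (simp add: q_def G_def sum.distrib sum_divide_distrib)
  also have "\<dots> \<le> sqrt ((1 + C / 2) * (of_int \<lfloor>q\<rfloor> + 1)) * G"
  proof -
    have "q \<le> of_int \<lfloor>q\<rfloor> + 1"
      by linarith
    then have "q + real K / 2 \<le> (1 + C / 2) * (of_int \<lfloor>q\<rfloor> + 1)"
      using K unfolding q_def[symmetric] by (simp add: field_simps)
    then show ?thesis
      using G0 by (intro mult_right_mono) auto
  qed
  finally have "(\<Sum>k=1..K. sqrt (P k / D + 1 / 2) * sqrt (\<Sum>t\<in>{r (k - 1)<..r k}. (\<gamma> t)\<^sup>2))
      \<le> sqrt (1 + C / 2) * sqrt (of_int \<lfloor>q\<rfloor> + 1) * G"
    by (simp add: real_sqrt_mult)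
  then have "2 * D * (\<Sum>k=1..K. sqrt (P k / D + 1 / 2) * sqrt (\<Sum>t\<in>{r (k - 1)<..r k}. (\<gamma> t)\<^sup>2))
      \<le> 2 * D * (sqrt (1 + C / 2) * sqrt (of_int \<lfloor>q\<rfloor> + 1) * G)"
    using D by (intro mult_left_mono) auto
  then show ?thesis
    by (simp add: restarted_regret_bound_def dynamic_regret_lower_bound_def q_def G_def
        sum_distrib_left mult_ac)
qed

theorem theorem3:
  shows "(\<forall>(S :: (real ^ 'n) set) K T r P f xstar x g.
            S \<noteq> {} \<and> convex S \<and> closed S \<and> bounded S \<and> diameter S > 0 \<and>
            reset_schedule K T r \<and>
            (\<forall>k\<in>{1..K}. 0 \<le> P k) \<and>
            (\<forall>t\<in>{1..T}. convex_on S (f t)) \<and>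
            (\<forall>t\<in>{1..T}. xstar t \<in> S) \<and>
            (\<forall>k\<in>{1..K}. (\<Sum>t\<in>{r (k - 1)<..<r k}. norm (xstar (Suc t) - xstar t)) \<le> P k) \<and>
            adaptive_restarted_run S K r P f x g
          \<longrightarrow> (\<Sum>t=1..T. f t (x t) - f t (xstar t))
                \<le> restarted_regret_bound (diameter S) K r P (\<lambda>t. norm (g t)))
       \<and> (\<forall>C :: real. \<exists>c :: real. \<forall>D K T r P \<gamma>.
            D > 0 \<and> reset_schedule K T r \<and> (\<forall>k\<in>{1..K}. 0 \<le> P k) \<and> (\<forall>t\<in>{1..T}. 0 \<le> \<gamma> t) \<and>
            real K \<le> C * (\<Sum>k=1..K. P k / D)
          \<longrightarrow> restarted_regret_bound D K r P \<gamma>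
                \<le> c * dynamic_regret_lower_bound D T (\<Sum>k=1..K. P k) \<gamma>)
       \<and> (\<forall>B :: real. \<exists>c :: real. \<forall>D K T r P \<gamma>.
            D > 0 \<and> reset_schedule K T r \<and> (\<forall>k\<in>{1..K}. 0 \<le> P k) \<and> (\<forall>t\<in>{1..T}. 0 \<le> \<gamma> t) \<and>
            real K \<le> B
          \<longrightarrow> restarted_regret_bound D K r P \<gamma>
                \<le> c * dynamic_regret_lower_bound D T (\<Sum>k=1..K. P k) \<gamma>)"
proof (intro conjI allI)
  fix S :: "(real ^ 'n) set" and K T r P f xstar x g
  show "S \<noteq> {} \<and> convex S \<and> closed S \<and> bounded S \<and> diameter S > 0 \<and>
            reset_schedule K T r \<and>
            (\<forall>k\<in>{1..K}. 0 \<le> P k) \<and>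
            (\<forall>t\<in>{1..T}. convex_on S (f t)) \<and>
            (\<forall>t\<in>{1..T}. xstar t \<in> S) \<and>
            (\<forall>k\<in>{1..K}. (\<Sum>t\<in>{r (k - 1)<..<r k}. norm (xstar (Suc t) - xstar t)) \<le> P k) \<and>
            adaptive_restarted_run S K r P f x g
          \<longrightarrow> (\<Sum>t=1..T. f t (x t) - f t (xstar t))
                \<le> restarted_regret_bound (diameter S) K r P (\<lambda>t. norm (g t))"
    by (intro impI restarted_regret) auto
next
  fix C :: real
  show "\<exists>c :: real. \<forall>D K T r P \<gamma>.
            D > 0 \<and> reset_schedule K T r \<and> (\<forall>k\<in>{1..K}. 0 \<le> P k) \<and> (\<forall>t\<in>{1..T}. 0 \<le> \<gamma> t) \<and>
            real K \<le> C * (\<Sum>k=1..K. P k / D)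
          \<longrightarrow> restarted_regret_bound D K r P \<gamma>
                \<le> c * dynamic_regret_lower_bound D T (\<Sum>k=1..K. P k) \<gamma>"
  proof (intro exI allI impI, elim conjE)
    fix D :: real and K T r and P \<gamma> :: "nat \<Rightarrow> real"
    assume A: "D > 0" "reset_schedule K T r" "\<forall>k\<in>{1..K}. 0 \<le> P k"
      and K: "real K \<le> C * (\<Sum>k=1..K. P k / D)"
    let ?q = "(\<Sum>k=1..K. P k) / D"
    have q0: "0 \<le> ?q"
      using A by (intro divide_nonneg_pos sum_nonneg) auto
    have "real K \<le> C * ?q"
      using K by (simp add: sum_divide_distrib)
    \<comment> \<open>The given \<open>C\<close> may have either sign; a nonnegative factor is
      needed to replace \<open>?q\<close> by the larger
      \<open>of_int \<lfloor>?q\<rfloor> + 1\<close>.\<close>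
    also have "\<dots> \<le> \<bar>C\<bar> * ?q"
      using q0 by (intro mult_right_mono) auto
    also have "\<dots> \<le> \<bar>C\<bar> * (of_int \<lfloor>?q\<rfloor> + 1)"
      by (intro mult_left_mono) (linarith, simp)
    finally show "restarted_regret_bound D K r P \<gamma>
        \<le> (4 * sqrt 2 * sqrt (1 + \<bar>C\<bar> / 2)) * dynamic_regret_lower_bound D T (\<Sum>k=1..K. P k) \<gamma>"
      using A by (intro restarted_regret_bound_le) auto
  qed
next
  fix B :: real
  show "\<exists>c :: real. \<forall>D K T r P \<gamma>.
            D > 0 \<and> reset_schedule K T r \<and> (\<forall>k\<in>{1..K}. 0 \<le> P k) \<and> (\<forall>t\<in>{1..T}. 0 \<le> \<gamma> t) \<and>
            real K \<le> B
          \<longrightarrow> restarted_regret_bound D K r P \<gamma>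
                \<le> c * dynamic_regret_lower_bound D T (\<Sum>k=1..K. P k) \<gamma>"
  proof (intro exI allI impI, elim conjE)
    fix D :: real and K T r and P \<gamma> :: "nat \<Rightarrow> real"
    assume A: "D > 0" "reset_schedule K T r" "\<forall>k\<in>{1..K}. 0 \<le> P k" and K: "real K \<le> B"
    let ?q = "(\<Sum>k=1..K. P k) / D"
    have "0 \<le> ?q"
      using A by (intro divide_nonneg_pos sum_nonneg) auto
    \<comment> \<open>A bounded \<open>K\<close> fits the common form because the rounded factor is
      at least 1.\<close>
    then have "1 \<le> of_int \<lfloor>?q\<rfloor> + (1::real)"
      by simp
    then have "\<bar>B\<bar> * 1 \<le> \<bar>B\<bar> * (of_int \<lfloor>?q\<rfloor> + 1)"
      by (intro mult_left_mono) auto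
    then have "real K \<le> \<bar>B\<bar> * (of_int \<lfloor>?q\<rfloor> + 1)"
      using K by linarith
    then show "restarted_regret_bound D K r P \<gamma>
        \<le> (4 * sqrt 2 * sqrt (1 + \<bar>B\<bar> / 2)) * dynamic_regret_lower_bound D T (\<Sum>k=1..K. P k) \<gamma>"
      using A by (intro restarted_regret_bound_le) auto
  qed
qed

end
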